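(* There exists an absolute constant $K$ such that for any integers $r\ge d\ge 3$ we have $$ \gamma_r(d) < 2^{0.5r + K(dr/\log_2 r)^{2/3}}. $$ Hence, if $d=d(r)\ge 3$ satisfies $d=o(\sqrt r\,\log_2 r)$ as $r\to\infty$, then $\gamma_r(d)<2^{(0.5+o(1))r}$ as $r\to\infty$.
   Context: Let $\mathbb{F}_2^r$ be the $r$-dimensional vector space over the two-element field, and let $0\le d\le r$ be an integer. A subset $C\subseteq\mathbb{F}_2^r$ is called $d$-complete if for every $v\in\mathbb{F}_2^r$ there exists a linear subspace $L_v\le\mathbb{F}_2^r$ of dimension $d$ such that $v+(L_v\setminus\{0\})\subseteq C$. By $\gamma_r(d)$ we denote the smallest possible size of a $d$-complete subset of $\mathbb{F}_2^r$. *)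

theory Defs
  imports Complex_Main "HOL-Library.Z2" "HOL-Library.Function_Algebras"
    "HOL-Library.Landau_Symbols"
begin

text \<open>
  Since the dimension \<open>r\<close> is quantified inside statements, the spaces \<open>\<F>\<^sub>2\<^sup>r\<close> are
  realised for all \<open>r\<close> simultaneously as subspaces of the vector space of all functions
  \<open>nat \<Rightarrow> bit\<close> (pointwise operations; \<open>bit\<close> is the two-element field): a vector of
  \<open>\<F>\<^sub>2\<^sup>r\<close> has coordinates \<open>0, \<dots>, r - 1\<close> and is padded with zeros.
\<close>

definition F2_scale :: "bit \<Rightarrow> (nat \<Rightarrow> bit) \<Rightarrow> (nat \<Rightarrow> bit)" where
  "F2_scale c v = (\<lambda>i. c * v i)"

global_interpretation F2: vector_space F2_scale
  by unfold_locales (simp_all only: F2_scale_def fun_eq_iff plus_fun_apply distrib_left distrib_right mult.assoc mult_1_left simp_thms)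

definition F2_space :: "nat \<Rightarrow> (nat \<Rightarrow> bit) set" where
  "F2_space r = {v. \<forall>i\<ge>r. v i = 0}"

lemma F2_subspace_F2_space: "F2.subspace (F2_space r)"
  unfolding F2.subspace_def by (simp add: F2_space_def F2_scale_def)

lemma F2_dim_F2_space: "F2.dim (F2_space r) = r"
proof -
  define e :: "nat \<Rightarrow> nat \<Rightarrow> bit" where "e i j = (if j = i then 1 else 0)" for i j
  have inj: "inj e"
  proof (rule injI)
    fix i j assume "e i = e j"
    then have "e i i = e j i" by simp
    then show "i = j" by (simp add: e_def split: if_splits)
  qed
  have sum_apply: "(\<Sum>i\<in>A. F2_scale (c i) (e i)) j = (if j \<in> A then c j else 0)"
    if "finite A" for A c j
    using that by (induction A rule: finite_induct) (auto simp: F2_scale_def e_def)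
  have "e ` {..<r} \<subseteq> F2_space r"
    by (auto simp: F2_space_def e_def)
  moreover have "F2_space r \<subseteq> F2.span (e ` {..<r})"
  proof
    fix v assume v: "v \<in> F2_space r"
    have "v = (\<Sum>i<r. F2_scale (v i) (e i))"
      using v by (auto simp: fun_eq_iff sum_apply F2_space_def)
    also have "\<dots> \<in> F2.span (e ` {..<r})"
      by (intro F2.span_sum F2.span_scale F2.span_base) auto
    finally show "v \<in> F2.span (e ` {..<r})" .
  qed
  moreover have "F2.independent (e ` {..<r})"
  proof (rule F2.independent_if_scalars_zero)
    fix f x assume 0: "(\<Sum>x\<in>e ` {..<r}. F2_scale (f x) x) = 0" and x: "x \<in> e ` {..<r}"
    have "(\<Sum>i<r. F2_scale (f (e i)) (e i)) = 0"
      using 0 inj by (simp add: sum.reindex inj_on_def)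
    then have "f (e j) = 0" if "j < r" for j
      using sum_apply[of "{..<r}" "\<lambda>i. f (e i)" j] that by simp
    then show "f x = 0" using x by auto
  qed simp
  ultimately have "F2.dim (F2_space r) = card (e ` {..<r})"
    by (intro F2.dim_unique) auto
  then show ?thesis
    using inj by (simp add: card_image inj_on_def)
qed

definition d_complete :: "nat \<Rightarrow> nat \<Rightarrow> (nat \<Rightarrow> bit) set \<Rightarrow> bool" where
  "d_complete r d C \<longleftrightarrow> C \<subseteq> F2_space r \<and>
    (\<forall>v\<in>F2_space r. \<exists>L. L \<subseteq> F2_space r \<and> F2.subspace L \<and> F2.dim L = d \<and>
       (\<lambda>x. v + x) ` (L - {0}) \<subseteq> C)"

lemma d_complete_F2_space:
  assumes "d \<le> r"
  shows "d_complete r d (F2_space r)"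
proof -
  have "F2_space d \<subseteq> F2_space r"
    using assms by (auto simp: F2_space_def)
  moreover have "(\<lambda>x. v + x) ` (F2_space d - {0}) \<subseteq> F2_space r" if "v \<in> F2_space r" for v
    using that assms by (auto simp: F2_space_def)
  ultimately show ?thesis
    unfolding d_complete_def
    by (intro conjI ballI exI[of _ "F2_space d"] order_refl
        F2_subspace_F2_space F2_dim_F2_space) auto
qed

text \<open>By the preceding lemma the minimum exists for \<open>d \<le> r\<close>; for \<open>d > r\<close> the value is unspecified.\<close>

definition \<gamma> :: "nat \<Rightarrow> nat \<Rightarrow> nat" where
  "\<gamma> r d = (LEAST n. \<exists>C. d_complete r d C \<and> card C = n)"

end

theory Submission
  imports Defs
begin

text \<open>
  Fix a binary linear code of length \<open>n\<close> and dimension \<open>d\<close>, and let \<open>C\<close> consist of the vectors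
  that vanish on the support of some nonzero codeword. For every \<open>v\<close>, the coordinatewise products
  \<open>c v\<close> with codewords \<open>c\<close> form a linear space, and \<open>v + c v = (1 + c) v\<close> vanishes on the support
  of \<open>c\<close>; so \<open>C\<close> is \<open>d\<close>-complete, up to \<open>d\<close> extra coordinates that ensure injectivity. If every
  nonzero codeword has at most \<open>n/2 + \<surd>(d n)\<close> zeros, then \<open>C\<close> has at most
  \<open>2\<^sup>d \<cdot> 2\<^bsup>n/2 + \<surd>(d n)\<^esup>\<close> elements. Such a code is built one coordinate at a time, keeping an
  exponential moment of the (zeros minus ones) counts below its average. The resulting exponent
  \<open>r/2 + O(\<surd>(d r))\<close> is stronger than required, as \<open>log r = O(r\<^bsup>1/4\<^esup>)\<close>.
\<close>

declare add_bit_eq_xor [simp del] mult_bit_eq_and [simp del]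

section \<open>Counting vectors with prescribed support\<close>

lemma card_F2_supported:
  assumes "finite A"
  shows "finite {x :: nat \<Rightarrow> bit. \<forall>i. i \<notin> A \<longrightarrow> x i = 0}"
    and "card {x :: nat \<Rightarrow> bit. \<forall>i. i \<notin> A \<longrightarrow> x i = 0} = 2 ^ card A"
proof -
  have bij: "bij_betw (\<lambda>x. {i. x i = 1}) {x :: nat \<Rightarrow> bit. \<forall>i. i \<notin> A \<longrightarrow> x i = 0} (Pow A)"
    by (rule bij_betw_byWitness[where f' = "\<lambda>S i. if i \<in> S then 1 else 0"])
       (auto simp: fun_eq_iff)
  show "finite {x :: nat \<Rightarrow> bit. \<forall>i. i \<notin> A \<longrightarrow> x i = 0}"
    using bij_betw_finite[OF bij] assms by simp
  show "card {x :: nat \<Rightarrow> bit. \<forall>i. i \<notin> A \<longrightarrow> x i = 0} = 2 ^ card A"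
    using bij_betw_same_card[OF bij] assms by (simp add: card_Pow)
qed

lemma F2_space_eq_supported: "F2_space r = {x. \<forall>i. i \<notin> {..<r} \<longrightarrow> x i = 0}"
  by (auto simp: F2_space_def)

lemma finite_F2_space: "finite (F2_space r)"
  unfolding F2_space_eq_supported by (rule card_F2_supported) simp

lemma card_F2_space: "card (F2_space r) = 2 ^ r"
  unfolding F2_space_eq_supported by (subst card_F2_supported) simp_all

lemma card_F2_space_nonzero_le: "real (card (F2_space d - {0})) \<le> 2 ^ d"
proof -
  have "card (F2_space d - {0}) \<le> 2 ^ d"
    unfolding card_F2_space[symmetric] by (intro card_mono finite_F2_space) auto
  then show ?thesis by simp
qed

section \<open>Linear functionals on \<open>F2_space d\<close> and their signs\<close>

definition F2_dot :: "nat \<Rightarrow> (nat \<Rightarrow> bit) \<Rightarrow> (nat \<Rightarrow> bit) \<Rightarrow> bit" where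
  "F2_dot d f l = (\<Sum>j<d. f j * l j)"

lemma F2_dot_zero_right [simp]: "F2_dot d f 0 = 0"
  by (simp add: F2_dot_def)

lemma F2_dot_add_left: "F2_dot d (f + g) l = F2_dot d f l + F2_dot d g l"
  by (simp add: F2_dot_def distrib_right sum.distrib)

lemma F2_dot_add_right: "F2_dot d f (l + m) = F2_dot d f l + F2_dot d f m"
  by (simp add: F2_dot_def distrib_left sum.distrib)

lemma F2_dot_scale_right: "F2_dot d f (F2_scale c l) = c * F2_dot d f l"
  by (simp add: F2_dot_def F2_scale_def sum_distrib_left mult.left_commute)

text \<open>The nontrivial additive character of the two-element field: summed over the coordinates
  of a codeword it gives the number of zeros minus the number of ones.\<close>

definition F2_sign :: "bit \<Rightarrow> real" where
  "F2_sign b = (if b = 0 then 1 else - 1)"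

lemma F2_sign_add_one: "F2_sign (b + 1) = - F2_sign b"
  by (cases b) (simp_all add: F2_sign_def)

text \<open>The exponent \<open>x\<^sup>2\<close> instead of the sharp \<open>x\<^sup>2 / 2\<close>
  costs only a constant later, and elementary estimates suffice: up to 1 both sides are compared
  with \<open>1 + y\<^sup>2\<close>, beyond 1 with \<open>exp y\<close>.\<close>

lemma cosh_le_exp_square: "cosh x \<le> exp (x\<^sup>2)" for x :: real
proof -
  have "cosh y \<le> exp (y\<^sup>2)" if y: "y \<ge> 0" for y :: real
  proof (cases "y \<le> 1")
    case True
    have "inverse (exp y) \<le> inverse (1 + y)"
      using y exp_ge_add_one_self[of y] by (intro le_imp_inverse_le) auto
    moreover have "inverse (1 + y) \<le> 1 - y + y\<^sup>2"
    proof -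
      \<comment> \<open>The product equals \<open>1 + y ^ 3\<close>.\<close>
      have "1 \<le> (1 - y + y\<^sup>2) * (1 + y)"
        using y by (simp add: algebra_simps power2_eq_square)
      then show ?thesis using y by (simp add: field_simps)
    qed
    ultimately have "exp (- y) \<le> 1 - y + y\<^sup>2" by (simp add: exp_minus)
    then have "cosh y \<le> 1 + y\<^sup>2"
      using exp_bound[OF y True] by (simp add: cosh_field_def)
    also have "\<dots> \<le> exp (y\<^sup>2)" by (rule exp_ge_add_one_self)
    finally show ?thesis .
  next
    case False
    then have "y \<le> y\<^sup>2" by (simp add: power2_eq_square)
    have "cosh y \<le> exp y"
      using cosh_plus_sinh[of y] sinh_real_nonneg_iff[of y] y by linarith
    also have "\<dots> \<le> exp (y\<^sup>2)" using \<open>y \<le> y\<^sup>2\<close> by simp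
    finally show ?thesis .
  qed
  from this[of "\<bar>x\<bar>"] show ?thesis by simp
qed

text \<open>Adding a unit vector \<open>e\<close> with \<open>F2_dot d e l = 1\<close> exchanges the vectors orthogonal to \<open>l\<close>
  with the others.\<close>

lemma sum_exp_F2_sign_dot:
  assumes "l \<in> F2_space d" "l \<noteq> 0"
  shows "(\<Sum>f\<in>F2_space d. exp (c * F2_sign (F2_dot d f l))) = 2 ^ d * cosh c"
proof -
  obtain j where j: "l j \<noteq> 0" using assms(2) by (auto simp: fun_eq_iff)
  have jd: "j < d"
  proof (rule ccontr)
    assume "\<not> j < d"
    then have "l j = 0" using assms(1) by (simp add: F2_space_def)
    with j show False ..
  qed
  define e :: "nat \<Rightarrow> bit" where "e = (\<lambda>i. if i = j then 1 else 0)"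
  have "F2_dot d e l = (\<Sum>i<d. if i = j then l i else 0)"
    unfolding F2_dot_def e_def by (rule sum.cong) auto
  then have e: "F2_dot d e l = 1" using j jd by simp
  have ee: "(f + e) + e = f" for f by (auto simp: fun_eq_iff e_def)
  have "bij_betw (\<lambda>f. f + e) (F2_space d) (F2_space d)"
    by (rule bij_betw_byWitness[where f' = "\<lambda>f. f + e"])
       (use jd in \<open>auto simp: ee F2_space_def e_def\<close>)
  from sum.reindex_bij_betw[OF this, of "\<lambda>f. exp (c * F2_sign (F2_dot d f l))"]
  have "(\<Sum>f\<in>F2_space d. exp (c * F2_sign (F2_dot d f l))) =
        (\<Sum>f\<in>F2_space d. exp (- (c * F2_sign (F2_dot d f l))))"
    by (simp add: F2_dot_add_left e F2_sign_add_one)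
  then have "2 * (\<Sum>f\<in>F2_space d. exp (c * F2_sign (F2_dot d f l))) =
        (\<Sum>f\<in>F2_space d. exp (c * F2_sign (F2_dot d f l)) + exp (- (c * F2_sign (F2_dot d f l))))"
    by (simp add: sum.distrib)
  \<comment> \<open>Whatever the sign, each pair is \<open>exp c + exp (- c)\<close>.\<close>
  also have "\<dots> = (\<Sum>f\<in>F2_space d. 2 * cosh c)"
    by (rule sum.cong) (auto simp: cosh_field_def F2_sign_def)
  also have "\<dots> = 2 * (2 ^ d * cosh c)" by (simp add: card_F2_space)
  finally show ?thesis by simp
qed

section \<open>Exponential moments and codes with few zeros\<close>

lemma ex_le_average:
  fixes g :: "'a \<Rightarrow> real"
  assumes "finite A" "A \<noteq> {}" "(\<Sum>x\<in>A. g x) = real (card A) * m"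
  obtains x where "x \<in> A" "g x \<le> m"
proof -
  have "\<exists>x\<in>A. g x \<le> m"
  proof (rule ccontr)
    assume "\<not> ?thesis"
    then have "(\<Sum>x\<in>A. m) < (\<Sum>x\<in>A. g x)"
      using assms by (intro sum_strict_mono) auto
    then show False using assms by simp
  qed
  then show ?thesis using that by blast
qed

text \<open>The probabilistic method, one coordinate at a time: a uniformly random new functional
  multiplies the expected moment by exactly \<open>cosh c\<close>, so some choice does no worse. The
  zero message is left out because its weight would grow by \<open>exp c\<close> instead.\<close>

lemma ex_small_exp_moment:
  "\<exists>f. (\<Sum>l\<in>F2_space d - {0}. exp (c * (\<Sum>i<n. F2_sign (F2_dot d (f i) l)))) \<le> 2 ^ d * cosh c ^ n"
proof (induction n)
  case 0
  have "(\<Sum>l\<in>F2_space d - {0}. exp (c * (\<Sum>i<0::nat. F2_sign (F2_dot d 0 l)))) \<le> 2 ^ d * cosh c ^ 0"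
    using card_F2_space_nonzero_le[of d] by simp
  then show ?case by (intro exI[of _ "\<lambda>_. 0"])
next
  case (Suc n)
  then obtain f where
    *: "(\<Sum>l\<in>F2_space d - {0}. exp (c * (\<Sum>i<n. F2_sign (F2_dot d (f i) l)))) \<le> 2 ^ d * cosh c ^ n"
    by blast
  define w where "w l = exp (c * (\<Sum>i<n. F2_sign (F2_dot d (f i) l)))" for l
  have "(\<Sum>g\<in>F2_space d. \<Sum>l\<in>F2_space d - {0}. w l * exp (c * F2_sign (F2_dot d g l)))
      = (\<Sum>l\<in>F2_space d - {0}. w l * (\<Sum>g\<in>F2_space d. exp (c * F2_sign (F2_dot d g l))))"
    by (subst sum.swap) (simp add: sum_distrib_left)
  also have "\<dots> = (\<Sum>l\<in>F2_space d - {0}. w l * (2 ^ d * cosh c))"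
    by (intro sum.cong refl) (simp add: sum_exp_F2_sign_dot)
  also have "\<dots> = real (card (F2_space d)) * (cosh c * (\<Sum>l\<in>F2_space d - {0}. w l))"
    by (simp add: card_F2_space sum_distrib_left mult_ac)
  finally obtain g where g:
    "(\<Sum>l\<in>F2_space d - {0}. w l * exp (c * F2_sign (F2_dot d g l)))
       \<le> cosh c * (\<Sum>l\<in>F2_space d - {0}. w l)"
    by (rule ex_le_average[rotated 2]) (use finite_F2_space F2.subspace_0[OF F2_subspace_F2_space] in blast)+
  have "(\<Sum>l\<in>F2_space d - {0}. exp (c * (\<Sum>i<Suc n. F2_sign (F2_dot d ((f(n := g)) i) l))))
      = (\<Sum>l\<in>F2_space d - {0}. w l * exp (c * F2_sign (F2_dot d g l)))"
    by (intro sum.cong refl) (simp add: w_def distrib_left exp_add)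
  also have "\<dots> \<le> cosh c * (2 ^ d * cosh c ^ n)"
    using order_trans[OF g mult_left_mono[OF *[folded w_def] cosh_real_nonneg]] .
  finally have "(\<Sum>l\<in>F2_space d - {0}. exp (c * (\<Sum>i<Suc n. F2_sign (F2_dot d ((f(n := g)) i) l))))
      \<le> 2 ^ d * cosh c ^ Suc n"
    by (simp only: power_Suc mult_ac)
  then show ?case by (intro exI[of _ "f(n := g)"])
qed

text \<open>This is a Gilbert--Varshamov bound: \<open>i \<mapsto> F2_dot d (f i) l\<close> is the codeword of \<open>l\<close>.\<close>

lemma ex_code_few_zeros:
  "\<exists>f. \<forall>l\<in>F2_space d - {0}.
     real (card {i. i < n \<and> F2_dot d (f i) l = 0}) \<le> real n / 2 + sqrt (real d * real n)"
\<comment> \<open>In these cases the parameter \<open>c\<close> below would be 0; there are then no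
  coordinates to count or no nonzero messages.\<close>
proof (cases "n = 0 \<or> d = 0")
  case True
  then show ?thesis by (auto simp: F2_space_def fun_eq_iff)
next
  case False
  then have n: "n > 0" and d: "d > 0" by auto
  \<comment> \<open>The moment bound yields \<open>2 * card Z - n\<close> at most
    \<open>d / c + n * c\<close>, and this \<open>c\<close> balances the two terms at
    \<open>sqrt (d * n)\<close> each.\<close>
  define c where "c = sqrt (real d / real n)"
  have c: "c > 0" "c\<^sup>2 = real d / real n" using n d by (simp_all add: c_def)
  have sqrt_eq: "c * sqrt (real d * real n) = real d"
    using n unfolding c_def real_sqrt_mult[symmetric] by simp
  obtain f where
    *: "(\<Sum>l\<in>F2_space d - {0}. exp (c * (\<Sum>i<n. F2_sign (F2_dot d (f i) l)))) \<le> 2 ^ d * cosh c ^ n"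
    using ex_small_exp_moment[of c d n] by blast
  show ?thesis
  proof (intro exI[of _ f] ballI)
    fix l assume l: "l \<in> F2_space d - {0}"
    define Z where "Z = {i. i < n \<and> F2_dot d (f i) l = 0}"
    have Zn: "Z \<subseteq> {..<n}" by (auto simp: Z_def)
    have "(\<Sum>i<n. F2_sign (F2_dot d (f i) l)) = (\<Sum>i<n. 2 * (if i \<in> Z then 1 else 0) - 1)"
      by (rule sum.cong) (auto simp: F2_sign_def Z_def)
    also have "\<dots> = 2 * real (card Z) - real n"
      using Zn by (simp add: sum_subtractf sum_distrib_left[symmetric] sum.If_cases Int_absorb1)
    finally have S: "(\<Sum>i<n. F2_sign (F2_dot d (f i) l)) = 2 * real (card Z) - real n" .
    \<comment> \<open>A Markov-type bound: all terms of the moment are positive, so the one for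
      \<open>l\<close> is at most their sum.\<close>
    have "exp (c * (2 * real (card Z) - real n)) \<le> 2 ^ d * cosh c ^ n"
      unfolding S[symmetric]
      using member_le_sum[OF l, of "\<lambda>l. exp (c * (\<Sum>i<n. F2_sign (F2_dot d (f i) l)))"] *
      by (simp add: finite_F2_space)
    also have "\<dots> \<le> exp 1 ^ d * exp (c\<^sup>2) ^ n"
      using cosh_le_exp_square[of c] exp_ge_add_one_self[of 1]
      by (intro mult_mono power_mono) auto
    also have "\<dots> = exp (real d + real n * c\<^sup>2)"
      by (simp add: exp_add flip: exp_of_nat_mult)
    also have "real d + real n * c\<^sup>2 = c * (2 * sqrt (real d * real n))"
      using n c(2) sqrt_eq by simp
    finally have "2 * real (card Z) - real n \<le> 2 * sqrt (real d * real n)"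
      using c(1) by simp
    then show "real (card {i. i < n \<and> F2_dot d (f i) l = 0}) \<le> real n / 2 + sqrt (real d * real n)"
      by (simp add: Z_def)
  qed
qed

section \<open>From a code to a complete set\<close>

interpretation F2_pair: vector_space_pair F2_scale F2_scale
  by unfold_locales

lemma F2_linear_image:
  assumes add: "\<And>x y. \<phi> (x + y) = \<phi> x + \<phi> y"
    and scale: "\<And>c x. \<phi> (F2_scale c x) = F2_scale c (\<phi> x)"
    and inj: "inj_on \<phi> (F2_space d)"
  shows "F2.subspace (\<phi> ` F2_space d)" "F2.dim (\<phi> ` F2_space d) = d"
proof -
  have lin: "Vector_Spaces.linear F2_scale F2_scale \<phi>"
    unfolding Vector_Spaces.linear_iff using add scale F2.vector_space_axioms by blast
  show "F2.subspace (\<phi> ` F2_space d)"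
    by (rule F2_pair.linear_subspace_image[OF lin F2_subspace_F2_space])
  obtain B where B: "B \<subseteq> F2_space d" "F2.independent B" "F2_space d \<subseteq> F2.span B" "card B = d"
    using F2.basis_exists[of "F2_space d"] F2_dim_F2_space by metis
  have span: "F2.span B = F2_space d"
    using B F2.span_minimal[OF B(1) F2_subspace_F2_space] by blast
  show "F2.dim (\<phi> ` F2_space d) = d"
  proof (rule F2.dim_unique[where B = "\<phi> ` B"])
    show "\<phi> ` F2_space d \<subseteq> F2.span (\<phi> ` B)"
      using F2_pair.linear_span_image[OF lin, of B] span by simp
    show "F2.independent (\<phi> ` B)"
      using F2_pair.linear_independent_injective_image[OF lin B(2)] inj span by simp
    show "card (\<phi> ` B) = d"
      using B(1,4) card_image inj inj_on_subset by metis
  qed (use B(1) in auto)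
qed

text \<open>The last \<open>d\<close> coordinates only serve to keep the map \<open>\<phi>\<close> below injective, even where \<open>v\<close>
  has few nonzero coordinates.\<close>

lemma d_complete_of_code:
  fixes f :: "nat \<Rightarrow> nat \<Rightarrow> bit" and n d :: nat
  defines "C \<equiv> (\<Union>l\<in>F2_space d - {0}. {x \<in> F2_space (n + d). \<forall>i<n. F2_dot d (f i) l = 1 \<longrightarrow> x i = 0})"
  shows "d_complete (n + d) d C"
  unfolding d_complete_def
proof (intro conjI ballI)
  show "C \<subseteq> F2_space (n + d)" by (auto simp: C_def)
next
  fix v assume v: "v \<in> F2_space (n + d)"
  define \<phi> :: "(nat \<Rightarrow> bit) \<Rightarrow> nat \<Rightarrow> bit" where
    "\<phi> l i = (if i < n then F2_dot d (f i) l * v i else if i < n + d then l (i - n) else 0)" for l i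
  have add: "\<phi> (x + y) = \<phi> x + \<phi> y" for x y
    by (auto simp: \<phi>_def fun_eq_iff F2_dot_add_right distrib_right)
  have scale: "\<phi> (F2_scale c x) = F2_scale c (\<phi> x)" for c x
    by (auto simp: \<phi>_def fun_eq_iff F2_dot_scale_right mult.assoc F2_scale_def[of c "\<phi> x"])
       (simp add: F2_scale_def)
  have inj: "inj_on \<phi> (F2_space d)"
  proof (rule inj_onI)
    fix x y assume xy: "x \<in> F2_space d" "y \<in> F2_space d" "\<phi> x = \<phi> y"
    have "x j = y j" for j
    proof (cases "j < d")
      case True
      then show ?thesis using fun_cong[OF xy(3), of "n + j"] by (simp add: \<phi>_def)
    qed (use xy in \<open>auto simp: F2_space_def\<close>)
    then show "x = y" by auto
  qed
  have \<phi>_space: "\<phi> l \<in> F2_space (n + d)" for l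
    by (simp add: F2_space_def \<phi>_def)
  have "v + \<phi> l \<in> C" if "l \<in> F2_space d" "\<phi> l \<noteq> 0" for l
  proof -
    have "\<phi> 0 = 0" by (simp add: \<phi>_def fun_eq_iff)
    then have "l \<noteq> 0" using that(2) by auto
    moreover have "v + \<phi> l \<in> F2_space (n + d)"
      by (rule F2.subspace_add[OF F2_subspace_F2_space v \<phi>_space])
    \<comment> \<open>Where the codeword is 1, \<open>\<phi> l\<close> copies \<open>v\<close>, and
      the two cancel in characteristic 2.\<close>
    moreover have "(v + \<phi> l) i = 0" if "i < n" "F2_dot d (f i) l = 1" for i
      using that by (cases "v i") (simp_all add: \<phi>_def)
    ultimately show ?thesis
      using that(1) unfolding C_def by (intro UN_I[of l] CollectI conjI allI impI DiffI) auto
  qed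
  then have "(+) v ` (\<phi> ` F2_space d - {0}) \<subseteq> C" by blast
  moreover have "\<phi> ` F2_space d \<subseteq> F2_space (n + d)" using \<phi>_space by blast
  ultimately show "\<exists>L\<subseteq>F2_space (n + d). F2.subspace L \<and> F2.dim L = d \<and> (+) v ` (L - {0}) \<subseteq> C"
    using F2_linear_image[of \<phi> d, OF add scale inj]
    by (intro exI[of _ "\<phi> ` F2_space d"] conjI)
qed

section \<open>The upper bound with exponent \<open>r / 2 + O(sqrt (d * r))\<close>\<close>

lemma \<gamma>_le_card: "d_complete r d C \<Longrightarrow> \<gamma> r d \<le> card C"
  unfolding \<gamma>_def by (rule Least_le) blast

text \<open>A union bound over the nonzero messages. The exponent gains \<open>d\<close> from their
  number and another \<open>d\<close> from the free extra coordinates; as \<open>d \<le> r\<close>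
  gives \<open>d \<le> sqrt (d * r)\<close>, these and the code's own error make up the constant
  3.\<close>

lemma \<gamma>_le:
  assumes "d \<le> r"
  shows "real (\<gamma> r d) \<le> 2 powr (real r / 2 + 3 * sqrt (real d * real r))"
proof -
  define n where "n = r - d"
  have r: "r = n + d" using assms by (simp add: n_def)
  obtain f where f: "\<And>l. l \<in> F2_space d - {0} \<Longrightarrow>
      real (card {i. i < n \<and> F2_dot d (f i) l = 0}) \<le> real n / 2 + sqrt (real d * real n)"
    using ex_code_few_zeros[of d n] by blast
  define D where "D l = {x \<in> F2_space (n + d). \<forall>i<n. F2_dot d (f i) l = 1 \<longrightarrow> x i = 0}" for l
  have D: "real (card (D l)) \<le> 2 powr (real n / 2 + sqrt (real d * real n) + real d)"
    if l: "l \<in> F2_space d - {0}" for l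
  proof -
    define A where "A = {i. i < n \<and> F2_dot d (f i) l = 0} \<union> {n..<n + d}"
    have finA: "finite A" by (simp add: A_def)
    have "D l = {x. \<forall>i. i \<notin> A \<longrightarrow> x i = 0}"
      by (auto simp: D_def A_def F2_space_def)
    then have "real (card (D l)) = 2 powr real (card A)"
      using card_F2_supported(2)[OF finA] by (simp add: powr_realpow)
    also have "card A = card {i. i < n \<and> F2_dot d (f i) l = 0} + d"
      unfolding A_def by (subst card_Un_disjoint) auto
    finally show ?thesis using f[OF l] by simp
  qed
  have "real (\<gamma> r d) \<le> real (card (\<Union>l\<in>F2_space d - {0}. D l))"
    using \<gamma>_le_card[OF d_complete_of_code[of n d f]] by (simp add: r D_def)
  also have "\<dots> \<le> (\<Sum>l\<in>F2_space d - {0}. real (card (D l)))"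
    using card_UN_le[of "F2_space d - {0}" D] finite_F2_space
    by (metis finite_Diff of_nat_mono of_nat_sum)
  also have "\<dots> \<le> real (card (F2_space d - {0})) * 2 powr (real n / 2 + sqrt (real d * real n) + real d)"
    using D by (rule sum_bounded_above)
  also have "\<dots> \<le> 2 powr real d * 2 powr (real n / 2 + sqrt (real d * real n) + real d)"
    using card_F2_space_nonzero_le[of d] by (intro mult_right_mono) (simp_all add: powr_realpow)
  also have "\<dots> = 2 powr (real n / 2 + sqrt (real d * real n) + 2 * real d)"
    by (simp add: powr_add[symmetric] algebra_simps)
  also have "\<dots> \<le> 2 powr (real r / 2 + 3 * sqrt (real d * real r))"
  proof -
    have "real d \<le> sqrt (real d * real r)"
      using assms by (intro real_le_rsqrt) (simp add: power2_eq_square mult_left_mono)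
    moreover have "sqrt (real d * real n) \<le> sqrt (real d * real r)"
      by (simp add: r mult_left_mono)
    moreover have "real r = real n + real d" by (simp add: r)
    ultimately have "real n / 2 + sqrt (real d * real n) + 2 * real d
        \<le> real r / 2 + 3 * sqrt (real d * real r)" by linarith
    then show ?thesis by simp
  qed
  finally show ?thesis .
qed

section \<open>Comparison with the exponent that contains the logarithm\<close>

lemma log2_le_root4:
  fixes x :: real
  assumes "x > 0"
  shows "log 2 x \<le> 8 * x powr (1/4)"
proof -
  have ln2: "1 / 2 \<le> ln (2 :: real)"
    by (subst ln_ge_iff) (use exp_bound[of "1/2"] in \<open>simp_all add: power2_eq_square\<close>)
  \<comment> \<open>Applying \<open>ln y \<le> y\<close> to the fourth root costs a factor 4, and
    the change to base 2 another factor 2.\<close>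
  have "ln x / 4 = ln (x powr (1/4))" using assms by (simp add: ln_powr)
  also have "\<dots> \<le> x powr (1/4)" using ln_bound[of "x powr (1/4)"] assms by simp
  finally have "ln x \<le> 4 * x powr (1/4)" by simp
  also have "\<dots> \<le> (8 * x powr (1/4)) * ln 2"
    using ln2 mult_left_mono[OF ln2, of "8 * x powr (1/4)"] by simp
  finally show ?thesis by (simp add: log_def divide_le_eq)
qed

text \<open>After clearing the logarithm, \<open>(d * r) powr (1/6)\<close> is left to absorb
  \<open>log 2 r powr (2/3)\<close>. This is why the logarithm was compared with a fourth root: 1/4
  times 2/3 is 1/6.\<close>

lemma sqrt_le_powr_div_log:
  fixes d r :: real
  assumes "d \<ge> 1" "r > 1"
  shows "sqrt (d * r) \<le> 4 * (d * r / log 2 r) powr (2/3)"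
proof -
  have lg: "log 2 r > 0" using assms by simp
  have "log 2 r powr (2/3) \<le> (8 * r powr (1/4)) powr (2/3)"
    using log2_le_root4[of r] lg assms by (intro powr_mono2) auto
  also have "\<dots> = 8 powr (2/3) * r powr (1/6)"
    using assms by (simp add: powr_mult powr_powr)
  also have "8 powr (2/3) = (4 :: real)"
  proof -
    have "(8 :: real) powr (2/3) = (2 powr 3) powr (2/3)" by simp
    also have "\<dots> = 2 powr 2" unfolding powr_powr by simp
    finally show ?thesis by simp
  qed
  also have "4 * r powr (1/6) \<le> 4 * (d * r) powr (1/6)"
    using assms by (simp add: powr_mono2)
  finally have "log 2 r powr (2/3) \<le> 4 * (d * r) powr (1/6)" .
  then have "(d * r) powr (1/2) * log 2 r powr (2/3)
      \<le> (d * r) powr (1/2) * (4 * (d * r) powr (1/6))"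
    by (intro mult_left_mono) auto
  also have "\<dots> = 4 * (d * r) powr (2/3)"
    using assms by (simp add: powr_add[symmetric])
  finally have "sqrt (d * r) * log 2 r powr (2/3) \<le> 4 * (d * r) powr (2/3)"
    using assms by (simp add: powr_half_sqrt)
  moreover have "log 2 r powr (2/3) > 0"
    using lg by (metis less_irrefl powr_gt_zero)
  ultimately have "sqrt (d * r) \<le> 4 * (d * r) powr (2/3) / log 2 r powr (2/3)"
    by (simp only: pos_le_divide_eq)
  then show ?thesis
    using assms lg by (simp add: powr_divide)
qed

text \<open>The two constants multiply to 12; the excess in 13 makes the inequality strict, since
  the power is positive.\<close>

lemma \<gamma>_less:
  assumes "3 \<le> d" "d \<le> r"
  shows "real (\<gamma> r d) < 2 powr (0.5 * real r + 13 * (real d * real r / log 2 (real r)) powr (2/3))"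
proof -
  have "log 2 (real r) > 0" using assms by (subst zero_less_log_cancel_iff) auto
  then have "real d * real r / log 2 (real r) > 0"
    using assms by (intro divide_pos_pos mult_pos_pos) auto
  then have pos: "(real d * real r / log 2 (real r)) powr (2/3) > 0"
    by (metis less_irrefl powr_gt_zero)
  have "sqrt (real d * real r) \<le> 4 * (real d * real r / log 2 (real r)) powr (2/3)"
    using assms by (intro sqrt_le_powr_div_log) auto
  with pos have "real r / 2 + 3 * sqrt (real d * real r)
      < 0.5 * real r + 13 * (real d * real r / log 2 (real r)) powr (2/3)"
    by linarith
  then have "2 powr (real r / 2 + 3 * sqrt (real d * real r))
      < 2 powr (0.5 * real r + 13 * (real d * real r / log 2 (real r)) powr (2/3))"
    by (intro powr_less_mono) auto
  with \<gamma>_le[OF assms(2)] show ?thesis by linarith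
qed

section \<open>The asymptotic consequence\<close>

lemma powr_div_log_eq:
  fixes d r :: real
  assumes "d \<ge> 0" "r > 1"
  shows "(d * r / log 2 r) powr (2/3) = (d / (sqrt r * log 2 r)) powr (2/3) * r"
proof -
  have lg: "log 2 r > 0" using assms by simp
  \<comment> \<open>The split-off factor \<open>r powr (3/2)\<close> becomes exactly
    \<open>r\<close> under the power 2/3.\<close>
  have eq: "d * r / log 2 r = d / (sqrt r * log 2 r) * r powr (3/2)"
  proof -
    have "r powr (3/2) = r powr (1 + 1/2)" by simp
    also have "\<dots> = r * sqrt r" using assms unfolding powr_add by (simp add: powr_half_sqrt)
    finally show ?thesis using assms lg by simp
  qed
  have "d / (sqrt r * log 2 r) \<ge> 0" using assms lg by simp
  then show ?thesis unfolding eq using assms by (simp only: powr_mult powr_powr powr_ge_zero) simp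
qed

theorem theorem6:
  shows "(\<exists>K::real. \<forall>r d::nat. 3 \<le> d \<and> d \<le> r \<longrightarrow>
            real (\<gamma> r d) < 2 powr (0.5 * real r + K * (real d * real r / log 2 (real r)) powr (2/3)))
       \<and> (\<forall>d::nat \<Rightarrow> nat.
            (\<forall>\<^sub>F r in at_top. 3 \<le> d r \<and> d r \<le> r) \<and>
            (\<lambda>r. real (d r)) \<in> o[at_top](\<lambda>r. sqrt (real r) * log 2 (real r)) \<longrightarrow>
            (\<exists>\<epsilon>::nat \<Rightarrow> real. \<epsilon> \<longlonglongrightarrow> 0 \<and>
               (\<forall>\<^sub>F r in at_top. real (\<gamma> r (d r)) < 2 powr ((0.5 + \<epsilon> r) * real r))))"
proof (intro conjI allI impI)
  show "\<exists>K::real. \<forall>r d::nat. 3 \<le> d \<and> d \<le> r \<longrightarrow>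
      real (\<gamma> r d) < 2 powr (0.5 * real r + K * (real d * real r / log 2 (real r)) powr (2/3))"
    using \<gamma>_less by blast
next
  fix d :: "nat \<Rightarrow> nat"
  assume asm: "(\<forall>\<^sub>F r in at_top. 3 \<le> d r \<and> d r \<le> r) \<and>
    (\<lambda>r. real (d r)) \<in> o[at_top](\<lambda>r. sqrt (real r) * log 2 (real r))"
  \<comment> \<open>The ratio that the little-o hypothesis sends to 0; the error term is
    \<open>13 * q r powr (2/3)\<close>.\<close>
  define q where "q r = real (d r) / (sqrt (real r) * log 2 (real r))" for r
  have q_nonneg: "q r \<ge> 0" if "r \<ge> 1" for r
    using that by (simp add: q_def)
  have "q \<longlonglongrightarrow> 0"
    using smalloD_tendsto[OF conjunct2[OF asm]] by (simp add: q_def[abs_def])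
  \<comment> \<open>The limit base is 0, where passing to the limit in the power relies on
    \<open>q\<close> being eventually nonnegative.\<close>
  then have "(\<lambda>r. 13 * q r powr (2/3)) \<longlonglongrightarrow> 13 * 0 powr (2/3)"
    by (intro tendsto_mult tendsto_const tendsto_powr2)
       (auto simp: q_nonneg intro!: eventually_sequentiallyI[of 1])
  moreover have "\<forall>\<^sub>F r in at_top. real (\<gamma> r (d r)) < 2 powr ((0.5 + 13 * q r powr (2/3)) * real r)"
    using conjunct1[OF asm]
  proof eventually_elim
    case (elim r)
    then have "(real (d r) * real r / log 2 (real r)) powr (2/3) = q r powr (2/3) * real r"
      unfolding q_def by (intro powr_div_log_eq) auto
    with \<gamma>_less[of "d r" r] elim show ?case by (simp add: algebra_simps)
  qed
  ultimately show "\<exists>\<epsilon>::nat \<Rightarrow> real. \<epsilon> \<longlonglongrightarrow> 0 \<and>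
      (\<forall>\<^sub>F r in at_top. real (\<gamma> r (d r)) < 2 powr ((0.5 + \<epsilon> r) * real r))"
    by (intro exI[of _ "\<lambda>r. 13 * q r powr (2/3)"]) simp
qed

end
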